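(* Let $q>1$ be odd and $p=2$. For all $U\in\mathbb{N}$, $$W(qU)\ge W(qU+1)\ge W(qU-1),$$ and for $0\le r<q-1$, $W(qU+r)\ge W(qU+r+1)$.
   Context: A strictly chained $(2,q)$-ary partition of $U$ is a finite sequence of distinct positive integers of the form $2^aq^b$ ($a,b\ge0$) summing to $U$, in decreasing order, each part a multiple of the next. $W(U)$ is the number of such partitions of $U$, with $W(0)=1$ and $W(x)=0$ if $x$ is not a nonnegative integer (so $W(-1)=0$). *)

theory Defs
  imports Main
begin

definition strictly_chained_partition :: "nat \<Rightarrow> nat \<Rightarrow> nat list \<Rightarrow> bool" where
  "strictly_chained_partition p q xs \<longleftrightarrow>
     (\<forall>x\<in>set xs. \<exists>a b. x = p ^ a * q ^ b) \<and>
     sorted_wrt (>) xs \<and>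
     successively (\<lambda>x y. y dvd x) xs"

text \<open>
  The argument is an integer, so that the convention \<open>W(x) = 0\<close> for negative \<open>x\<close> is
  part of the definition.
\<close>

definition W :: "nat \<Rightarrow> nat \<Rightarrow> int \<Rightarrow> nat" where
  "W p q x = card {xs. strictly_chained_partition p q xs \<and> int (sum_list xs) = x}"

lemma finite_strictly_chained_partitions:
  "finite {xs. strictly_chained_partition p q xs \<and> int (sum_list xs) = x}"
proof (rule finite_subset)
  show "{xs. strictly_chained_partition p q xs \<and> int (sum_list xs) = x}
        \<subseteq> {xs. set xs \<subseteq> {..nat x} \<and> distinct xs}"
  proof clarify
    fix xs assume xs: "strictly_chained_partition p q xs"
    have "rev (rev xs) = xs" by simp
    moreover have "sorted_wrt (<) (rev xs)"
      using xs by (simp add: strictly_chained_partition_def sorted_wrt_rev)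
    ultimately have "distinct xs"
      using strict_sorted_iff distinct_rev by blast
    thus "set xs \<subseteq> {..nat (int (sum_list xs))} \<and> distinct xs"
      by (auto intro: member_le_sum_list)
  qed
  show "finite {xs. set xs \<subseteq> {..nat x} \<and> distinct xs}"
    by (rule finite_subset_distinct) simp
qed

lemma W_neg: "x < 0 \<Longrightarrow> W p q x = 0"
  by (auto simp: W_def)

lemma W_0:
  assumes "p > 0" "q > 0"
  shows "W p q 0 = 1"
proof -
  have "xs = []" if "strictly_chained_partition p q xs" "sum_list xs = 0" for xs
    using that assms by (cases xs) (auto simp: strictly_chained_partition_def)
  hence "{xs. strictly_chained_partition p q xs \<and> int (sum_list xs) = 0} = {[]}"
    by (auto simp: strictly_chained_partition_def)
  thus ?thesis by (simp add: W_def)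
qed

end

theory Submission
  imports Defs
begin

text \<open>
  Let \<open>W\<^sub>0(n)\<close> count the partitions of \<open>n\<close> without the part 1. Removing the part 1 gives
  \<open>W(n + 1) = W\<^sub>0(n + 1) + W\<^sub>0(n)\<close>, and since the smallest part divides all others,
  inclusion-exclusion gives \<open>W\<^sub>0(n) = W(n/2) + W(n/q) - W(n/2q)\<close>, where a term counts as 0
  if its argument is not an integer. Thus \<open>W(n) = W(\<lfloor>n/2\<rfloor>)\<close> unless \<open>n mod q\<close> is 0 or 1, and
  strong induction shows \<open>0 \<le> W(qU + r) - W(qU + r + 1) \<le> W(U)\<close> for \<open>r < q - 1\<close>.
  For \<open>q = 2k + 1\<close> and \<open>U = 2V + 1\<close>, these recursions read \<open>W(qU - 1) = W(qV + k)\<close> and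
  \<open>W(qU + 1) = W(U) + W(qV + k + 1)\<close>, so that the upper bound together with
  \<open>W(V) \<le> W(U)\<close> yields \<open>W(qU - 1) \<le> W(qU + 1)\<close>.
\<close>

section \<open>Partitions as strict divisibility chains\<close>

lemma strictly_chained_partition_iff:
  "strictly_chained_partition p q xs \<longleftrightarrow>
     (\<forall>x\<in>set xs. \<exists>a b. x = p ^ a * q ^ b) \<and> sorted_wrt (\<lambda>x y. y < x \<and> y dvd x) xs"
proof -
  \<comment> \<open>By transitivity the condition on neighbours reaches all pairs, so both order
    conditions merge into one relation that is easy to push through append and map.\<close>
  have "successively (\<lambda>x y. y dvd x) xs \<longleftrightarrow> sorted_wrt (\<lambda>x y. y dvd x) xs"
    by (rule successively_iff_sorted_wrt_strong) (auto intro: dvd_trans)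
  moreover have "sorted_wrt (\<lambda>x y. P x y \<and> Q x y) xs \<longleftrightarrow> sorted_wrt P xs \<and> sorted_wrt Q xs"
    for P Q :: "nat \<Rightarrow> nat \<Rightarrow> bool"
    by (induction xs) auto
  ultimately show ?thesis
    by (simp add: strictly_chained_partition_def)
qed

definition chained_partitions :: "nat \<Rightarrow> nat \<Rightarrow> nat \<Rightarrow> nat list set" where
  "chained_partitions p q n = {xs. strictly_chained_partition p q xs \<and> sum_list xs = n}"

lemma W_of_nat: "W p q (int n) = card (chained_partitions p q n)"
  by (simp add: W_def chained_partitions_def)

lemma finite_chained_partitions [simp]: "finite (chained_partitions p q n)"
  using finite_strictly_chained_partitions[of p q "int n"] by (simp add: chained_partitions_def)

definition W_without_1 :: "nat \<Rightarrow> nat \<Rightarrow> nat \<Rightarrow> nat" where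
  "W_without_1 p q n = card {xs \<in> chained_partitions p q n. 1 \<notin> set xs}"

lemma sum_list_map_mult: "sum_list (map ((*) d) xs) = d * sum_list xs" for d :: nat
  by (induction xs) (auto simp: algebra_simps)

section \<open>Recursions for coprime bases\<close>

context
  fixes p q :: nat
  assumes p: "p > 1" and q: "q > 1" and coprime: "coprime p q"
begin

lemma parts_ge_1: "strictly_chained_partition p q xs \<Longrightarrow> x \<in> set xs \<Longrightarrow> x \<ge> 1"
  using p q by (fastforce simp: strictly_chained_partition_iff)

text \<open>The number 1 is \<open>p ^ 0 * q ^ 0\<close>, divides every part and exceeds none, so
  appending it can only fail by repeating a part.\<close>

lemma strictly_chained_partition_snoc_1:
  "strictly_chained_partition p q (xs @ [1]) \<longleftrightarrow> strictly_chained_partition p q xs \<and> 1 \<notin> set xs"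
proof -
  have "\<exists>a b. 1 = p ^ a * q ^ b"
    by (rule exI[of _ 0], rule exI[of _ 0]) simp
  thus ?thesis
    using parts_ge_1[of xs]
    by (auto simp: strictly_chained_partition_iff sorted_wrt_append order_le_less)
qed

lemma strictly_chained_partition_with_1:
  assumes "strictly_chained_partition p q xs" "1 \<in> set xs"
  shows "\<exists>ys. xs = ys @ [1]"
proof (cases xs rule: rev_cases)
  case (snoc ys y)
  have "y = 1"
    using assms parts_ge_1[OF assms(1), of y] snoc
    by (fastforce simp: strictly_chained_partition_iff sorted_wrt_append)
  with snoc show ?thesis by auto
qed (use assms in auto)

lemma W_Suc: "W p q (int (Suc n)) = W_without_1 p q (Suc n) + W_without_1 p q n"
proof -
  let ?P = "chained_partitions p q (Suc n)"
  let ?Q = "{xs \<in> chained_partitions p q n. 1 \<notin> set xs}"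
  have "xs \<in> (\<lambda>xs. xs @ [1]) ` ?Q" if xs: "xs \<in> ?P" "1 \<in> set xs" for xs
  proof -
    obtain ys where ys: "xs = ys @ [1]"
      using strictly_chained_partition_with_1 xs by (auto simp: chained_partitions_def)
    hence "ys \<in> ?Q"
      using xs strictly_chained_partition_snoc_1[of ys] by (simp add: chained_partitions_def)
    with ys show ?thesis by blast
  qed
  moreover have "xs @ [1] \<in> ?P" if "xs \<in> ?Q" for xs
    using that strictly_chained_partition_snoc_1[of xs] by (simp add: chained_partitions_def)
  ultimately have "{xs \<in> ?P. 1 \<in> set xs} = (\<lambda>xs. xs @ [1]) ` ?Q"
    by auto
  hence "card {xs \<in> ?P. 1 \<in> set xs} = W_without_1 p q n"
    by (simp add: W_without_1_def card_image inj_on_def)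
  moreover have "card ({xs \<in> ?P. 1 \<notin> set xs} \<union> {xs \<in> ?P. 1 \<in> set xs}) =
      card {xs \<in> ?P. 1 \<notin> set xs} + card {xs \<in> ?P. 1 \<in> set xs}"
    by (rule card_Un_disjoint) auto
  moreover have "{xs \<in> ?P. 1 \<notin> set xs} \<union> {xs \<in> ?P. 1 \<in> set xs} = ?P"
    by auto
  ultimately show ?thesis
    by (simp add: W_of_nat W_without_1_def del: of_nat_Suc)
qed

lemma power_mult_power_dvd_iff:
  "p ^ c * q ^ e dvd p ^ a * q ^ b \<longleftrightarrow> c \<le> a \<and> e \<le> b"
proof
  assume dvd: "p ^ c * q ^ e dvd p ^ a * q ^ b"
  hence "p ^ c dvd p ^ a * q ^ b" "q ^ e dvd p ^ a * q ^ b"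
    by (auto dest: dvd_mult_left dvd_mult_right)
  hence "p ^ c dvd p ^ a" "q ^ e dvd q ^ b"
    using coprime by (auto simp: coprime_dvd_mult_left_iff coprime_dvd_mult_right_iff coprime_commute)
  thus "c \<le> a \<and> e \<le> b"
    using p q by (auto dest: power_dvd_imp_le)
qed (auto intro: mult_dvd_mono le_imp_power_dvd)

text \<open>Scaling by \<open>d\<close> preserves order and divisibility, and comparing exponents
  shows that dividing by \<open>d\<close> keeps parts of the form \<open>p ^ a * q ^ b\<close>. This
  gives a bijection with the partitions of \<open>n div d\<close>.\<close>

lemma card_chained_partitions_multiples:
  fixes c e
  defines "d \<equiv> p ^ c * q ^ e"
  shows "card {xs \<in> chained_partitions p q n. \<forall>x\<in>set xs. d dvd x} =
           (if d dvd n then W p q (int (n div d)) else 0)"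
proof -
  have d: "d > 0" using p q by (simp add: d_def)
  have smooth: "(\<exists>a b. d * x = p ^ a * q ^ b) \<longleftrightarrow> (\<exists>a b. x = p ^ a * q ^ b)" for x
  proof
    assume "\<exists>a b. d * x = p ^ a * q ^ b"
    then obtain a b where ab: "d * x = p ^ a * q ^ b" by blast
    hence "c \<le> a" "e \<le> b"
      using power_mult_power_dvd_iff[of c e a b] by (metis d_def dvd_triv_left)+
    hence "d * x = d * (p ^ (a - c) * q ^ (b - e))"
      unfolding ab by (simp add: d_def algebra_simps flip: power_add)
    thus "\<exists>a b. x = p ^ a * q ^ b" using d by auto
  next
    assume "\<exists>a b. x = p ^ a * q ^ b"
    then obtain a b where "x = p ^ a * q ^ b" by blast
    hence "d * x = p ^ (c + a) * q ^ (e + b)" by (simp add: d_def power_add)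
    thus "\<exists>a b. d * x = p ^ a * q ^ b" by blast
  qed
  have chained: "strictly_chained_partition p q (map ((*) d) xs) \<longleftrightarrow> strictly_chained_partition p q xs"
    for xs using d by (simp add: strictly_chained_partition_iff sorted_wrt_map smooth)
  have multiples: "\<exists>ys. xs = map ((*) d) ys" if "\<forall>x\<in>set xs. d dvd x" for xs
    using that by (intro exI[of _ "map (\<lambda>x. x div d) xs"]) (simp add: map_idI)
  show ?thesis
  proof (cases "d dvd n")
    case True
    hence "{xs \<in> chained_partitions p q n. \<forall>x\<in>set xs. d dvd x} =
             map ((*) d) ` chained_partitions p q (n div d)"
      using d chained
      by (auto simp: chained_partitions_def sum_list_map_mult dest!: multiples)
    moreover have "inj (map ((*) d))" using d by (intro injI) (auto dest: map_injective simp: inj_on_def)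
    hence "card (map ((*) d) ` chained_partitions p q (n div d)) = W p q (int (n div d))"
      by (simp only: W_of_nat card_image[OF inj_on_subset[OF _ subset_UNIV]])
    ultimately show ?thesis using True by simp
  next
    case False
    moreover have "d dvd sum_list xs" if "\<forall>x\<in>set xs. d dvd x" for xs
      using that by (induction xs) auto
    ultimately have "{xs \<in> chained_partitions p q n. \<forall>x\<in>set xs. d dvd x} = {}"
      by (auto simp: chained_partitions_def)
    thus ?thesis using False by simp
  qed
qed

lemma W_le_W_without_1_mult: "W p q (int n) \<le> W_without_1 p q (p * n)"
proof -
  have "W p q (int n) = card {xs \<in> chained_partitions p q (p * n). \<forall>x\<in>set xs. p dvd x}"
    using card_chained_partitions_multiples[of "p * n" 1 0] p by simp
  also have "\<dots> \<le> W_without_1 p q (p * n)"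
    unfolding W_without_1_def using p by (intro card_mono) auto
  finally show ?thesis .
qed

text \<open>The last part divides all others; if it is not 1, then \<open>p\<close> or
  \<open>q\<close> divides it and hence every part.\<close>

lemma not_1_in_parts_iff:
  assumes "strictly_chained_partition p q xs"
  shows "1 \<notin> set xs \<longleftrightarrow> (\<forall>x\<in>set xs. p dvd x) \<or> (\<forall>x\<in>set xs. q dvd x)"
proof
  assume no1: "1 \<notin> set xs"
  show "(\<forall>x\<in>set xs. p dvd x) \<or> (\<forall>x\<in>set xs. q dvd x)"
  proof (cases xs rule: rev_cases)
    case (snoc ys y)
    obtain a b where y: "y = p ^ a * q ^ b"
      using assms snoc by (auto simp: strictly_chained_partition_iff)
    have "\<not> (a = 0 \<and> b = 0)" using no1 snoc y by auto
    hence "p dvd y \<or> q dvd y"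
      unfolding y by (cases a; cases b) auto
    moreover have "\<forall>x\<in>set xs. y dvd x"
      using assms snoc by (auto simp: strictly_chained_partition_iff sorted_wrt_append)
    ultimately show ?thesis by (meson dvd_trans)
  qed auto
qed (use p q in auto)

text \<open>Inclusion-exclusion, where coprimality identifies the intersection with the multiples of
  \<open>p * q\<close>. The correction stays on the left because subtraction on nat
  truncates.\<close>

lemma W_without_1_rec:
  "W_without_1 p q n + (if p * q dvd n then W p q (int (n div (p * q))) else 0) =
     (if p dvd n then W p q (int (n div p)) else 0) +
     (if q dvd n then W p q (int (n div q)) else 0)"
proof -
  define A where "A = (\<lambda>d. {xs \<in> chained_partitions p q n. \<forall>x\<in>set xs. d dvd x})"
  have fin: "finite (A d)" for d by (simp add: A_def)
  have "{xs \<in> chained_partitions p q n. 1 \<notin> set xs} = A p \<union> A q"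
    using not_1_in_parts_iff by (auto simp: A_def chained_partitions_def)
  moreover have "A p \<inter> A q = A (p * q)"
    using coprime by (auto simp: A_def intro: divides_mult dvd_mult_left dvd_mult_right)
  ultimately have "W_without_1 p q n + card (A (p * q)) = card (A p) + card (A q)"
    using card_Un_Int[OF fin fin, of p q] by (simp add: W_without_1_def)
  thus ?thesis
    using card_chained_partitions_multiples[of n 1 0] card_chained_partitions_multiples[of n 0 1]
      card_chained_partitions_multiples[of n 1 1]
    by (simp add: A_def cong: if_cong)
qed

end

section \<open>Explicit recursions for p = 2 and q = 2k + 1\<close>

context
  fixes q k :: nat and w w0 :: "nat \<Rightarrow> nat"
  defines "w \<equiv> \<lambda>n. W 2 q (int n)" and "w0 \<equiv> W_without_1 2 q"
  assumes q: "q = 2 * k + 1" and k: "k \<ge> 1"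
begin

lemma w_Suc: "w (Suc n) = w0 (Suc n) + w0 n"
  unfolding w_def w0_def using q k by (intro W_Suc) auto

lemma w0_rec:
  "w0 n + (if 2 * q dvd n then w (n div (2 * q)) else 0) =
     (if even n then w (n div 2) else 0) + (if q dvd n then w (n div q) else 0)"
  unfolding w_def w0_def using q k by (intro W_without_1_rec) auto

lemma w0_not_dvd:
  assumes "\<not> q dvd n"
  shows "w0 n = (if even n then w (n div 2) else 0)"
proof -
  have "\<not> 2 * q dvd n" using assms by (meson dvd_mult_right)
  thus ?thesis using w0_rec[of n] assms by simp
qed

lemma w0_odd_mult: "w0 (q * (2 * V + 1)) = w (2 * V + 1)"
proof -
  define n where "n = q * (2 * V + 1)"
  have "odd n" using q by (simp add: n_def)
  moreover from this have "\<not> 2 * q dvd n" by (meson dvd_mult_left)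
  moreover have "q dvd n" "n div q = 2 * V + 1"
    unfolding n_def by (rule dvd_triv_left, rule nonzero_mult_div_cancel_left) (use q in simp)
  ultimately show ?thesis using w0_rec[of n] by (simp add: n_def)
qed

lemma w0_even_mult: "w0 (2 * q * V) + w V = w (q * V) + w (2 * V)"
proof -
  define n where "n = 2 * q * V"
  have "q > 0" using q by simp
  have "n div 2 = q * V" "n div (2 * q) = V" "even n" "q dvd n" "2 * q dvd n"
    using \<open>q > 0\<close> by (simp_all add: n_def)
  moreover have "n = q * (2 * V)" by (simp add: n_def)
  hence "n div q = 2 * V" using \<open>q > 0\<close> by simp
  ultimately show ?thesis using w0_rec[of n] by (simp add: n_def)
qed

lemma not_dvd_add: "0 < r \<Longrightarrow> r < q \<Longrightarrow> \<not> q dvd q * U + r"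
  by (auto dest: nat_dvd_not_less simp: dvd_add_right_iff)

text \<open>Neither the argument nor its predecessor is a multiple of \<open>q\<close>, so of the
  two \<open>w0\<close> terms only the one at the even number survives.\<close>

lemma w_mid:
  assumes "2 \<le> r" "r < q"
  shows "w (q * U + r) = w ((q * U + r) div 2)"
proof -
  obtain s where r: "r = Suc s" "0 < s" using assms by (cases r) auto
  have "\<not> q dvd q * U + s" "\<not> q dvd Suc (q * U + s)"
    using not_dvd_add[of s U] not_dvd_add[of r U] assms r by auto
  thus ?thesis by (simp add: r w_Suc w0_not_dvd)
qed

text \<open>The predecessor of a positive multiple of \<open>2 * q\<close> is odd and not divisible
  by \<open>q\<close>, so it contributes 0.\<close>

lemma w_even_mult: "w (q * (2 * V)) + w V = w (q * V) + w (2 * V)"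
proof (cases V)
  case 0
  thus ?thesis by simp
next
  case (Suc v)
  have eq: "q * (2 * V) = Suc (q * (2 * v + 1) + 2 * k)"
    using Suc q by simp
  have "\<not> q dvd q * (2 * v + 1) + 2 * k" "odd (q * (2 * v + 1) + 2 * k)"
    using not_dvd_add[of "2 * k" "2 * v + 1"] q k by auto
  hence "w (q * (2 * V)) = w0 (q * (2 * V))"
    unfolding eq w_Suc by (simp add: w0_not_dvd)
  thus ?thesis using w0_even_mult[of V] by (simp add: mult_ac)
qed

lemma w_even_mult_Suc: "w (q * (2 * V) + 1) + w V = w (q * V) + w (2 * V)"
proof -
  have "w0 (Suc (q * (2 * V))) = 0"
    using not_dvd_add[of 1 "2 * V"] q k by (subst w0_not_dvd) auto
  thus ?thesis using w0_even_mult[of V] by (simp add: mult_ac w_Suc)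
qed

lemma w_odd_mult: "w (q * (2 * V + 1)) = w (2 * V + 1) + w (q * V + k)"
proof -
  have eq: "q * (2 * V + 1) = Suc (q * (2 * V) + 2 * k)" using q by simp
  have "w0 (q * (2 * V) + 2 * k) = w (q * V + k)"
    using not_dvd_add[of "2 * k" "2 * V"] q k by (subst w0_not_dvd) (auto simp: mult_ac)
  thus ?thesis
    using w0_odd_mult[of V] unfolding eq w_Suc by simp
qed

lemma w_odd_mult_Suc: "w (q * (2 * V + 1) + 1) = w (2 * V + 1) + w (q * V + k + 1)"
proof -
  have "q * (2 * V + 1) + 1 = 2 * (q * V + k + 1)" using q by (simp add: algebra_simps)
  hence "even (q * (2 * V + 1) + 1)" "(q * (2 * V + 1) + 1) div 2 = q * V + k + 1"
    by simp_all
  moreover have "\<not> q dvd q * (2 * V + 1) + 1"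
    using q k by (intro not_dvd_add) auto
  ultimately have "w0 (q * (2 * V + 1) + 1) = w (q * V + k + 1)"
    using w0_not_dvd by simp
  thus ?thesis
    using w0_odd_mult[of V] w_Suc[of "q * (2 * V + 1)"] by simp
qed

section \<open>Comparison of neighbouring values\<close>

lemma w_le_w0_double: "w n \<le> w0 (2 * n)"
  unfolding w_def w0_def using q k by (intro W_le_W_without_1_mult) auto

lemma w_le_w_double: "w n \<le> w (2 * n)"
  using w_le_w0_double[of n] w_Suc[of "2 * n - 1"] by (cases n) auto

lemma w_le_w_double_Suc: "w n \<le> w (2 * n + 1)"
  using w_le_w0_double[of n] w_Suc[of "2 * n"] by auto

lemma w_even_mult_add:
  assumes "2 \<le> r" "r \<le> 2 * k"
  shows "w (q * (2 * V) + r) = w (q * V + r div 2)"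
proof -
  have "(q * (2 * V) + r) div 2 = q * V + r div 2" by simp
  thus ?thesis using assms q by (subst w_mid) auto
qed

lemma w_odd_mult_add:
  assumes "2 \<le> r" "r \<le> 2 * k"
  shows "w (q * (2 * V + 1) + r) = w (q * V + (k + (r + 1) div 2))"
proof -
  \<comment> \<open>The extra \<open>q\<close> is \<open>2 * k + 1\<close>: its even part halves to
    \<open>k\<close>, and the remaining 1 joins \<open>r\<close>.\<close>
  have "q * (2 * V + 1) + r = 2 * (q * V + k) + (r + 1)"
    using q by (simp add: algebra_simps)
  hence "(q * (2 * V + 1) + r) div 2 = q * V + (k + (r + 1) div 2)"
    by simp
  thus ?thesis using assms q by (subst w_mid) auto
qed

text \<open>With \<open>V = U div 2\<close>, halving turns the drop at \<open>r\<close> into 0 or a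
  drop in the block of \<open>V\<close>, except at \<open>r = 1\<close>, where \<open>w U\<close>
  enters. The upper bound serves the later comparison across a multiple of \<open>q\<close>.\<close>

lemma w_descent:
  assumes "r < 2 * k"
  shows "w (q * U + r + 1) \<le> w (q * U + r) \<and> w (q * U + r) \<le> w (q * U + r + 1) + w U"
  using assms
\<comment> \<open>Induction on \<open>U\<close> would stall at \<open>U = 0\<close>, where
  \<open>V = U\<close> and only the remainder shrinks.\<close>
proof (induction "q * U + r" arbitrary: U r rule: less_induct)
  case less
  define V where "V = U div 2"
  have IH: "w (q * V + s + 1) \<le> w (q * V + s)" "w (q * V + s) \<le> w (q * V + s + 1) + w V"
    if "q * V + s < q * U + r" "s < 2 * k" for s
    using less(1)[of V s] that by auto
  show ?case
  proof (cases "even U")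
    case True
    hence U: "U = 2 * V" by (simp add: V_def)
    have fU: "w V \<le> w U" using w_le_w_double U by simp
    consider "r = 0" | "r = 1" | "r \<ge> 2" by linarith
    thus ?thesis
    proof cases
      case 1
      thus ?thesis using w_even_mult[of V] w_even_mult_Suc[of V] U by simp
    next
      \<comment> \<open>The drop here is the drop at \<open>q * V\<close> plus
        \<open>w U - w V\<close>, so both bounds carry over.\<close>
      case 2
      have "w (q * U + r + 1) = w (q * V + 0 + 1)"
        using w_even_mult_add[of 2 V] 2 k U by simp
      moreover have "w (q * U + r) + w V = w (q * V + 0) + w U"
        using w_even_mult_Suc[of V] 2 U by simp
      ultimately show ?thesis
        using IH[of 0] 2 k U fU by simp
    next
      case 3
      have *: "w (q * U + r) = w (q * V + r div 2)"
        "w (q * U + r + 1) = w (q * V + (r + 1) div 2)"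
        using w_even_mult_add[of r V] w_even_mult_add[of "r + 1" V] 3 less.prems U
        by (simp_all add: add.assoc)
      show ?thesis
      \<comment> \<open>Consecutive arguments have equal halves for even \<open>r\<close> and
        consecutive halves for odd \<open>r\<close>. For odd \<open>U\<close> the parities swap
        roles.\<close>
      proof (cases "even r")
        case True
        thus ?thesis unfolding * by simp
      next
        case False
        hence "(r + 1) div 2 = r div 2 + 1" by simp
        moreover have "q * V + r div 2 < q * U + r" "r div 2 < 2 * k"
          using 3 less.prems by (simp_all add: U add_le_less_mono)
        ultimately show ?thesis
          unfolding * using IH[of "r div 2"] fU by (simp add: add.assoc)
      qed
    qed
  next
    case False
    hence U: "U = 2 * V + 1" by (simp add: V_def)
    have fU: "w V \<le> w U" using w_le_w_double_Suc U by simp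
    have qU: "q * U = q * V + (q * V + 2 * k + 1)"
      using q by (simp add: U algebra_simps)
    consider "r = 0" | "r = 1" | "r \<ge> 2" by linarith
    thus ?thesis
    proof cases
      case 1
      have "w (q * U + r) = w U + w (q * V + k)" "w (q * U + r + 1) = w U + w (q * V + k + 1)"
        using w_odd_mult[of V] w_odd_mult_Suc[of V] 1 U by simp_all
      thus ?thesis
        using IH[of k] 1 k qU fU by simp
    next
      \<comment> \<open>Both values involve the same halved argument, so the drop is exactly
        \<open>w U\<close> and the upper bound is attained.\<close>
      case 2
      have "w (q * U + r) = w U + w (q * V + k + 1)"
        using w_odd_mult_Suc[of V] 2 U by simp
      moreover have "w (q * U + r + 1) = w (q * V + k + 1)"
        using w_odd_mult_add[of 2 V] 2 k U by (simp add: add.assoc)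
      ultimately show ?thesis by simp
    next
      case 3
      have *: "w (q * U + r) = w (q * V + (k + (r + 1) div 2))"
        "w (q * U + r + 1) = w (q * V + (k + (r + 2) div 2))"
        using w_odd_mult_add[of r V] w_odd_mult_add[of "r + 1" V] 3 less.prems U
        by (simp_all add: add.assoc)
      show ?thesis
      proof (cases "even r")
        case False
        hence "(r + 2) div 2 = (r + 1) div 2" by presburger
        thus ?thesis unfolding * by simp
      next
        case True
        \<comment> \<open>For even \<open>r\<close> this is \<open>k + r div 2\<close>, which stays
          below \<open>2 * k\<close> because \<open>r < 2 * k\<close>.\<close>
        define s where "s = k + (r + 1) div 2"
        have "s < 2 * k" "s < r + 2 * k" "k + (r + 2) div 2 = s + 1"
          using True 3 less.prems by (auto simp: s_def elim!: evenE)
        thus ?thesis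
          unfolding * s_def[symmetric] using IH[of s] fU qU by (simp add: add.assoc)
      qed
    qed
  qed
qed

text \<open>For even \<open>U\<close> the claim reduces to \<open>U div 2\<close>; for odd
  \<open>U\<close> it follows from the upper bound of \<open>w_descent\<close> at remainder
  \<open>k\<close>.\<close>

lemma w_before_le_w_after:
  assumes "U > 0"
  shows "w (q * U - 1) \<le> w (q * U + 1)"
  using assms
proof (induction U rule: less_induct)
  case (less U)
  define V where "V = U div 2"
  show ?case
  proof (cases "even U")
    case True
    hence U: "U = 2 * V" and V: "V > 0" "V < U" using less.prems by (auto simp: V_def)
    \<comment> \<open>The predecessor has remainder \<open>2 * k\<close> in an odd block, and
      halving it gives the predecessor of \<open>q * V\<close>.\<close>
    have "q * U - 1 = q * (2 * (V - 1) + 1) + 2 * k" "q * (V - 1) + 2 * k = q * V - 1"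
      using V q by (cases V; simp add: U algebra_simps)+
    hence "w (q * U - 1) = w (q * V - 1)"
      using w_odd_mult_add[of "2 * k" "V - 1"] k by (simp del: mult_Suc_right flip: mult_2)
    also have "\<dots> \<le> w (q * V + 1)" using less.IH V by blast
    also have "\<dots> \<le> w (q * V)" using w_descent[of 0 V] k by simp
    also have "\<dots> \<le> w (q * U + 1)"
      using w_even_mult_Suc[of V] w_le_w_double[of V] U by simp
    finally show ?thesis .
  next
    case False
    hence U: "U = 2 * V + 1" by (simp add: V_def)
    have "q * U - 1 = q * (2 * V) + 2 * k" using q by (simp add: U)
    hence "w (q * U - 1) = w (q * V + k)"
      using w_even_mult_add[of "2 * k" V] k by simp
    \<comment> \<open>The possible loss \<open>w V\<close> is absorbed by the summand
      \<open>w U\<close> of \<open>w (q * U + 1)\<close>.\<close>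
    also have "\<dots> \<le> w (q * V + k + 1) + w V" using w_descent[of k V] k by simp
    also have "\<dots> \<le> w (q * U + 1)"
      using w_odd_mult_Suc[of V] w_le_w_double_Suc[of V] U by simp
    finally show ?thesis .
  qed
qed

end

theorem theorem5p3:
  fixes p q U :: nat
  assumes "q > 1" and "odd q" and "p = 2"
  shows "W p q (int (q * U)) \<ge> W p q (int (q * U) + 1) \<and>
         W p q (int (q * U) + 1) \<ge> W p q (int (q * U) - 1) \<and>
         (\<forall>r::nat. r < q - 1 \<longrightarrow> W p q (int (q * U + r)) \<ge> W p q (int (q * U + r + 1)))"
proof -
  obtain k where q: "q = 2 * k + 1" using assms by (auto elim: oddE)
  hence k: "k \<ge> 1" using assms by simp
  have descent: "W 2 q (int (q * U + r + 1)) \<le> W 2 q (int (q * U + r))" if "r < q - 1" for r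
    using w_descent[OF q k, of r U] that q by simp
  have "W 2 q (int (q * U) - 1) \<le> W 2 q (int (q * U) + 1)"
  \<comment> \<open>At \<open>U = 0\<close> the integer argument is -1, where \<open>W\<close>
    vanishes, while subtraction on nat would give 0.\<close>
  proof (cases "U = 0")
    case True
    thus ?thesis by (simp add: W_neg)
  next
    case False
    hence "int (q * U) - 1 = int (q * U - 1)" "int (q * U) + 1 = int (q * U + 1)"
      using assms by (simp_all add: of_nat_diff Suc_leI)
    thus ?thesis
      using w_before_le_w_after[OF q k, of U] False by (simp add: add.commute)
  qed
  moreover have "W 2 q (int (q * U) + 1) \<le> W 2 q (int (q * U))"
    using descent[of 0] assms by (simp add: add.commute)
  ultimately show ?thesis
    using descent assms by blast
qed

end
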